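(* Let $f:\mathbb{R}^n\times\mathbb{R}^l\to\overline{\mathbb{R}}$ be lower semicontinuous, set $\vartheta(y)=\inf_{x\in\mathbb{R}^n}f(x,y)$ and assume that $\vartheta$ is finite at $\bar y\in\mathbb{R}^l$. Let $S:\mathbb{R}^l\rightrightarrows\mathbb{R}^n$ be the solution mapping $S(y)=\mathrm{argmin}\,f(\cdot,y)$ and let $(v,\mu)\in\mathbb{R}^l\times\mathbb{R}$. For $\bar x\in S(\bar y)$ put $$A(\bar x)=\bigcup_{h:\ \mu\in Df(\bar x,\bar y)(h,v)}\partial f((\bar x,\bar y);(h,v,\mu)),\qquad B(\bar x)=\bigcup_{h\in\mathbb{S}:\ 0\in Df(\bar x,\bar y)(h,0)}\partial f((\bar x,\bar y);(h,0,0)).$$ (1) If $S$ is inner semicompact at $\bar y$ in direction $v$, then $y^*\in\partial\vartheta(\bar y;(v,\mu))$ implies $(0,y^* )\in\bigcup_{\bar x\in S(\bar y)}(A(\bar x)\cup B(\bar x))$. (2) If $\bar x\in S(\bar y)$ is such that $S$ is inner semicontinuous at $(\bar y,\bar x)$ in direction $v$, then $y^*\in\partial\vartheta(\bar y;(v,\mu))$ implies $(0,y^* )\in A(\bar x)\cup B(\bar x)$. (3) If $\bar x\in S(\bar y)$ is such that $S$ is inner calm at $(\bar y,\bar x)$ in direction $v$, then $y^*\in\partial\vartheta(\bar y;(v,\mu))$ implies $(0,y^* )\in A(\bar x)$.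
   Context: Euclidean norms are used; $\mathbb{S}$ is the unit sphere (here of $\mathbb{R}^n$) and $\mathbb{B}$ the closed unit ball; $t_k\downarrow0$ means $t_k>0$, $t_k\to0$; $\overline{\mathbb{R}}=\mathbb{R}\cup\{\pm\infty\}$; $\mathrm{argmin}\,f(\cdot,y)=\{x\mid f(x,y)=\vartheta(y)\}$. For $\Omega\subset\mathbb{R}^n$ and $x\in\Omega$: $T_\Omega(x)=\{u\mid\exists u_k\to u,\ t_k\downarrow0:\ x+t_ku_k\in\Omega\ \forall k\}$; $\hat N_\Omega(x)=\{\xi\mid\limsup_{x'\to x,\,x'\in\Omega}\langle\xi,x'-x\rangle/\|x'-x\|\le0\}$; both are empty if $x\notin\Omega$. The limiting normal cone in direction $u$ is $N_\Omega(x;u)=\{\xi\mid\exists t_k\downarrow0,\ u_k\to u,\ \xi_k\to\xi:\ \xi_k\in\hat N_\Omega(x+t_ku_k)\ \forall k\}$. For an extended-real-valued function $f$ on $\mathbb{R}^N$ finite at $z$: $\mathrm{epi}\,f=\{(w,\alpha)\in\mathbb{R}^{N+1}\mid\alpha\ge f(w)\}$; $\mathrm{gph}\,f=\{(w,f(w))\mid f(w)\in\mathbb{R}\}$; $Df(z)(u)=\{\mu\in\mathbb{R}\mid(u,\mu)\in T_{\mathrm{gph}\,f}(z,f(z))\}$; $\partial f(z;(u,\mu))=\{\xi\mid(\xi,-1)\in N_{\mathrm{epi}\,f}((z,f(z));(u,\mu))\}$. In $\partial f((\bar x,\bar y);(h,v,\mu))$ the direction is $(h,v)$ in the domain and $\mu$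 in the range. A directional neighborhood of $v$ is a set containing $\mathcal{V}_{\rho,\delta}(v):=\{z\in\rho\mathbb{B}\mid\big\|\|v\|z-\|z\|v\big\|\le\delta\|z\|\|v\|\}$ for some $\rho,\delta>0$. For $S:\mathbb{R}^l\rightrightarrows\mathbb{R}^n$ consider sequences $y_k=\bar y+t_kv_k$ with $t_k\downarrow0$, $v_k\to v$. - $S$ is inner semicompact at $\bar y$ in direction $v$ if for every such sequence there are an infinite $K\subset\mathbb{N}$ and a convergent sequence $(x_k)_{k\in K}$ with $x_k\in S(y_k)$. - $S$ is inner semicontinuous at $(\bar y,\bar x)$, $\bar x\in S(\bar y)$, in direction $v$ if for every such sequence there are an infinite $K\subset\mathbb{N}$ and $x_k\in S(y_k)$, $k\in K$, with $x_k\to\bar x$. - $S$ is inner calm at $(\bar y,\bar x)$ in direction $v$ if there are $\kappa>0$ and a directional neighborhood $\mathcal{V}$ of $v$ with $\bar x\in S(y)+\kappa\|y-\bar y\|\mathbb{B}$ for all $y\in\bar y+\mathcal{V}$. *)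

theory Defs
  imports "HOL-Analysis.Analysis"
begin

definition lower_semicontinuous :: "('a::topological_space \<Rightarrow> ereal) \<Rightarrow> bool"
  where "lower_semicontinuous f \<longleftrightarrow> (\<forall>z. f z \<le> Liminf (at z) f)"

definition decr_to_zero :: "(nat \<Rightarrow> real) \<Rightarrow> bool"
  where "decr_to_zero t \<longleftrightarrow> (\<forall>k. t k > 0) \<and> t \<longlonglongrightarrow> 0"

definition tangent_cone :: "'a::real_normed_vector set \<Rightarrow> 'a \<Rightarrow> 'a set"
  where "tangent_cone \<Omega> x =
    {u. x \<in> \<Omega> \<and> (\<exists>w t. w \<longlonglongrightarrow> u \<and> decr_to_zero t \<and> (\<forall>k. x + t k *\<^sub>R w k \<in> \<Omega>))}"

text \<open>The filter \<open>at x within \<Omega>\<close> leaves out the point \<open>x\<close> itself. At an isolated point of \<open>\<Omega>\<close>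
  it is trivial, the upper limit is \<open>-\<infinity>\<close>, and the cone is the whole space.\<close>

definition regular_normal_cone :: "'a::real_inner set \<Rightarrow> 'a \<Rightarrow> 'a set"
  where "regular_normal_cone \<Omega> x =
    {\<xi>. x \<in> \<Omega> \<and> Limsup (at x within \<Omega>) (\<lambda>x'. ereal (\<xi> \<bullet> (x' - x) / norm (x' - x))) \<le> 0}"

definition dir_normal_cone :: "'a::real_inner set \<Rightarrow> 'a \<Rightarrow> 'a \<Rightarrow> 'a set"
  where "dir_normal_cone \<Omega> x u =
    {\<xi>. \<exists>t w \<zeta>. decr_to_zero t \<and> w \<longlonglongrightarrow> u \<and> \<zeta> \<longlonglongrightarrow> \<xi> \<and>
          (\<forall>k. \<zeta> k \<in> regular_normal_cone \<Omega> (x + t k *\<^sub>R w k))}"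

definition epi :: "('a \<Rightarrow> ereal) \<Rightarrow> ('a \<times> real) set"
  where "epi f = {(w, \<alpha>). f w \<le> ereal \<alpha>}"

definition gph :: "('a \<Rightarrow> ereal) \<Rightarrow> ('a \<times> real) set"
  where "gph f = {(w, \<alpha>). f w = ereal \<alpha>}"

text \<open>The graphical derivative and the directional subdifferential are meant at points \<open>z\<close> where
  \<open>f\<close> is finite; there \<open>real_of_ereal (f z)\<close> is the value \<open>f z\<close>. At other points both are empty.\<close>

definition graph_deriv :: "('a::real_normed_vector \<Rightarrow> ereal) \<Rightarrow> 'a \<Rightarrow> 'a \<Rightarrow> real set"
  where "graph_deriv f z u =
    {\<mu>. \<bar>f z\<bar> \<noteq> \<infinity> \<and> (u, \<mu>) \<in> tangent_cone (gph f) (z, real_of_ereal (f z))}"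

definition dir_subdiff :: "('a::real_inner \<Rightarrow> ereal) \<Rightarrow> 'a \<Rightarrow> 'a \<times> real \<Rightarrow> 'a set"
  where "dir_subdiff f z d =
    {\<xi>. \<bar>f z\<bar> \<noteq> \<infinity> \<and> (\<xi>, -1) \<in> dir_normal_cone (epi f) (z, real_of_ereal (f z)) d}"

definition dir_nbhd_base :: "real \<Rightarrow> real \<Rightarrow> 'a::real_normed_vector \<Rightarrow> 'a set"
  where "dir_nbhd_base \<rho> \<delta> v =
    {z \<in> cball 0 \<rho>. norm (norm v *\<^sub>R z - norm z *\<^sub>R v) \<le> \<delta> * norm z * norm v}"

definition dir_nbhd :: "'a::real_normed_vector \<Rightarrow> 'a set \<Rightarrow> bool"
  where "dir_nbhd v V \<longleftrightarrow> (\<exists>\<rho>>0. \<exists>\<delta>>0. dir_nbhd_base \<rho> \<delta> v \<subseteq> V)"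

text \<open>An infinite index set \<open>K\<close> is given by its increasing enumeration \<open>r\<close>, and a family
  \<open>(x\<^sub>k)\<close> over \<open>k \<in> K\<close> by the sequence whose \<open>j\<close>-th member belongs to the index \<open>r j\<close>.\<close>

definition inner_semicompact ::
    "('b::real_normed_vector \<Rightarrow> 'a::real_normed_vector set) \<Rightarrow> 'b \<Rightarrow> 'b \<Rightarrow> bool"
  where "inner_semicompact S ybar v \<longleftrightarrow>
    (\<forall>t w. decr_to_zero t \<and> w \<longlonglongrightarrow> v \<longrightarrow>
      (\<exists>r x. strict_mono (r :: nat \<Rightarrow> nat) \<and>
             (\<forall>j. x j \<in> S (ybar + t (r j) *\<^sub>R w (r j))) \<and> convergent x))"

definition inner_semicontinuous ::
    "('b::real_normed_vector \<Rightarrow> 'a::real_normed_vector set) \<Rightarrow> 'b \<Rightarrow> 'a \<Rightarrow> 'b \<Rightarrow> bool"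
  where "inner_semicontinuous S ybar xbar v \<longleftrightarrow>
    (\<forall>t w. decr_to_zero t \<and> w \<longlonglongrightarrow> v \<longrightarrow>
      (\<exists>r x. strict_mono (r :: nat \<Rightarrow> nat) \<and>
             (\<forall>j. x j \<in> S (ybar + t (r j) *\<^sub>R w (r j))) \<and> x \<longlonglongrightarrow> xbar))"

definition inner_calm ::
    "('b::real_normed_vector \<Rightarrow> 'a::real_normed_vector set) \<Rightarrow> 'b \<Rightarrow> 'a \<Rightarrow> 'b \<Rightarrow> bool"
  where "inner_calm S ybar xbar v \<longleftrightarrow>
    (\<exists>\<kappa>>0. \<exists>V. dir_nbhd v V \<and>
      (\<forall>y \<in> (+) ybar ` V. xbar \<in> (\<Union>x \<in> S y. cball x (\<kappa> * norm (y - ybar)))))"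

definition marginal :: "('a \<times> 'b \<Rightarrow> ereal) \<Rightarrow> 'b \<Rightarrow> ereal"
  where "marginal f y = (INF x. f (x, y))"

definition solution_map :: "('a \<times> 'b \<Rightarrow> ereal) \<Rightarrow> 'b \<Rightarrow> 'a set"
  where "solution_map f y = {x. f (x, y) = marginal f y}"

text \<open>The two unions of subdifferentials of \<open>f\<close> at \<open>(xbar, ybar)\<close> that bound the
  subdifferential of the marginal function in direction \<open>(v, \<mu>)\<close>.\<close>

definition subdiff_union ::
    "('a::real_inner \<times> 'b::real_inner \<Rightarrow> ereal) \<Rightarrow> 'b \<Rightarrow> 'b \<Rightarrow> real \<Rightarrow> 'a \<Rightarrow> ('a \<times> 'b) set"
  where "subdiff_union f ybar v \<mu> xbar =
    (\<Union>h \<in> {h. \<mu> \<in> graph_deriv f (xbar, ybar) (h, v)}.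
       dir_subdiff f (xbar, ybar) ((h, v), \<mu>))"

definition singular_subdiff_union ::
    "('a::real_inner \<times> 'b::real_inner \<Rightarrow> ereal) \<Rightarrow> 'b \<Rightarrow> 'a \<Rightarrow> ('a \<times> 'b) set"
  where "singular_subdiff_union f ybar xbar =
    (\<Union>h \<in> {h \<in> sphere 0 1. 0 \<in> graph_deriv f (xbar, ybar) (h, 0)}.
       dir_subdiff f (xbar, ybar) ((h, 0), 0))"

end

theory Submission
  imports Defs
begin

text \<open>
  A subgradient of the marginal function \<open>\<vartheta>\<close> is a limit of regular normals to \<open>epi \<vartheta>\<close> at points
  \<open>(y\<^sub>k, \<alpha>\<^sub>k)\<close> approaching \<open>(ybar, \<vartheta>(ybar))\<close> from the prescribed direction. Since the last component of
  these normals is negative in the limit, the base points lie on the graph of \<open>\<vartheta>\<close>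
  (\<open>value_eq_of_regular_normal_epi\<close>), so \<open>f (x, y\<^sub>k) = \<alpha>\<^sub>k\<close> for every solution \<open>x\<close> at \<open>y\<^sub>k\<close>.
  The projection \<open>(x, y, \<alpha>) \<mapsto> (y, \<alpha>)\<close> maps \<open>epi f\<close> into \<open>epi \<vartheta>\<close> and is nonexpansive, so each normal
  \<open>(\<xi>, c)\<close> to \<open>epi \<vartheta>\<close> lifts to a normal \<open>((0, \<xi>), c)\<close> to \<open>epi f\<close> over any solution
  (\<open>regular_normal_epi_marginal_lift\<close>).

  It remains to see from which direction the lifted points \<open>(x\<^sub>k, y\<^sub>k, \<alpha>\<^sub>k)\<close> approach
  \<open>(xbar, ybar, \<vartheta>(ybar))\<close> when \<open>x\<^sub>k \<rightarrow> xbar\<close>. The step length \<open>t\<^sub>k\<close> of \<open>y\<^sub>k\<close> may be replaced by any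
  other positive null sequence (\<open>graph_normals_marginal_lift\<close>), and after passing to a subsequence
  one of two choices gives a convergent direction (\<open>bounded_rate_or_dominating\<close>). If
  \<open>\<parallel>x\<^sub>k - xbar\<parallel> / t\<^sub>k\<close> stays bounded, then \<open>t\<^sub>k\<close> itself works, the direction is \<open>((h, v), \<mu>)\<close>, and the
  subgradient falls into the first union. If not, \<open>\<parallel>x\<^sub>k - xbar\<parallel>\<close> dominates \<open>t\<^sub>k\<close>; dividing by it
  makes the \<open>y\<close>- and value-components vanish and leaves a unit vector \<open>h\<close>, which is the second union.

  The three assumptions on the solution mapping only differ in what they say about \<open>x\<^sub>k\<close>: inner
  semicompactness gives some limit, which is a solution by lower semicontinuity; inner
  semicontinuity prescribes this limit; inner calmness bounds \<open>\<parallel>x\<^sub>k - xbar\<parallel> / t\<^sub>k\<close>, which leaves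
  only the first case.
\<close>

section \<open>Regular normals to epigraphs\<close>

text \<open>Replacing the upper limit of quotients by linear inequalities lets the trivial filter at an
  isolated point pass without a separate case.\<close>

lemma regular_normal_cone_iff:
  fixes \<Omega> :: "'a::real_inner set"
  shows "\<xi> \<in> regular_normal_cone \<Omega> x \<longleftrightarrow>
    x \<in> \<Omega> \<and> (\<forall>\<epsilon>>0. \<forall>\<^sub>F x' in at x within \<Omega>. \<xi> \<bullet> (x' - x) \<le> \<epsilon> * norm (x' - x))"
    (is "_ \<longleftrightarrow> _ \<and> ?R")
proof -
  let ?q = "\<lambda>x'. \<xi> \<bullet> (x' - x) / norm (x' - x)"
  have "Limsup (at x within \<Omega>) (\<lambda>x'. ereal (?q x')) \<le> 0 \<longleftrightarrow> ?R"
  proof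
    assume L: "Limsup (at x within \<Omega>) (\<lambda>x'. ereal (?q x')) \<le> 0"
    show ?R
    proof (intro allI impI)
      fix \<epsilon> :: real assume "\<epsilon> > 0"
      then have "0 < ereal \<epsilon>" by simp
      with L have "\<forall>\<^sub>F x' in at x within \<Omega>. ereal (?q x') < ereal \<epsilon>"
        unfolding Limsup_le_iff by blast
      moreover have "\<forall>\<^sub>F x' in at x within \<Omega>. x' \<noteq> x"
        by (simp add: eventually_at_filter)
      ultimately show "\<forall>\<^sub>F x' in at x within \<Omega>. \<xi> \<bullet> (x' - x) \<le> \<epsilon> * norm (x' - x)"
        by eventually_elim (simp add: field_simps)
    qed
  next
    assume R: ?R
    show "Limsup (at x within \<Omega>) (\<lambda>x'. ereal (?q x')) \<le> 0"
      unfolding Limsup_le_iff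
    proof (intro allI impI)
      fix b :: ereal assume "0 < b"
      then obtain \<epsilon> where \<epsilon>: "0 < ereal \<epsilon>" "ereal \<epsilon> < b"
        using ereal_dense2 by blast
      with R have "\<forall>\<^sub>F x' in at x within \<Omega>. \<xi> \<bullet> (x' - x) \<le> \<epsilon> * norm (x' - x)"
        by simp
      moreover have "\<forall>\<^sub>F x' in at x within \<Omega>. x' \<noteq> x"
        by (simp add: eventually_at_filter)
      ultimately show "\<forall>\<^sub>F x' in at x within \<Omega>. ereal (?q x') < b"
      proof eventually_elim
        case (elim x')
        then have "ereal (?q x') \<le> ereal \<epsilon>" by (simp add: field_simps)
        with \<epsilon>(2) show ?case by (rule le_less_trans[rotated])
      qed
    qed
  qed
  then show ?thesis by (simp add: regular_normal_cone_def)
qed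

text \<open>Strictly above the graph the epigraph contains a downward vertical segment, whose
  direction has a positive scalar product with any vector with negative last component.\<close>

lemma value_eq_of_regular_normal_epi:
  fixes g :: "'a::real_inner \<Rightarrow> ereal"
  assumes nrm: "(\<xi>, c) \<in> regular_normal_cone (epi g) (y, \<alpha>)" and "c < 0"
  shows "g y = ereal \<alpha>"
proof (rule ccontr)
  assume "g y \<noteq> ereal \<alpha>"
  moreover have "g y \<le> ereal \<alpha>"
    using nrm by (simp add: regular_normal_cone_iff epi_def)
  ultimately have "g y < ereal \<alpha>" by simp
  then obtain \<beta> where \<beta>: "g y < ereal \<beta>" "\<beta> < \<alpha>"
    using ereal_dense2 by fastforce
  have "0 < - c / 2" using \<open>c < 0\<close> by simp
  with nrm have "\<forall>\<^sub>F p in at (y, \<alpha>) within epi g.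
      (\<xi>, c) \<bullet> (p - (y, \<alpha>)) \<le> - c / 2 * norm (p - (y, \<alpha>))"
    unfolding regular_normal_cone_iff by blast
  then obtain d where "d > 0" and d: "\<And>p. \<lbrakk>p \<in> epi g; p \<noteq> (y, \<alpha>); dist p (y, \<alpha>) < d\<rbrakk> \<Longrightarrow>
      (\<xi>, c) \<bullet> (p - (y, \<alpha>)) \<le> - c / 2 * norm (p - (y, \<alpha>))"
    unfolding eventually_at by blast
  define s where "s = min (d / 2) (\<alpha> - \<beta>)"
  have s: "0 < s" "s < d" "s \<le> \<alpha> - \<beta>"
    using \<open>d > 0\<close> \<beta>(2) by (auto simp: s_def)
  have "ereal \<beta> \<le> ereal (\<alpha> - s)" using s by simp
  with \<beta>(1) have "g y \<le> ereal (\<alpha> - s)" by (meson less_le_trans less_imp_le)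
  then have "(\<xi>, c) \<bullet> ((y, \<alpha> - s) - (y, \<alpha>)) \<le> - c / 2 * norm ((y, \<alpha> - s) - (y, \<alpha>))"
    using s by (intro d) (auto simp: epi_def dist_Pair_Pair dist_real_def)
  then have "- c * s \<le> - c / 2 * s"
    using s by (simp add: norm_Pair)
  with s(1) \<open>c < 0\<close> show False by (simp add: field_simps)
qed

text \<open>Both the scalar product with \<open>((0, \<xi>), c)\<close> and membership in the epigraph of the marginal
  function only see the projection to \<open>(y, \<alpha>)\<close>, while dropping the \<open>x\<close>-component can only decrease the
  norm on the right-hand side.\<close>

lemma regular_normal_epi_marginal_lift:
  fixes f :: "'a::real_inner \<times> 'b::real_inner \<Rightarrow> ereal"
  assumes nrm: "(\<xi>, c) \<in> regular_normal_cone (epi (marginal f)) (y, \<alpha>)"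
    and val: "f (x, y) \<le> ereal \<alpha>"
  shows "((0, \<xi>), c) \<in> regular_normal_cone (epi f) ((x, y), \<alpha>)"
  unfolding regular_normal_cone_iff
proof (intro conjI allI impI)
  show "((x, y), \<alpha>) \<in> epi f" using val by (simp add: epi_def)
next
  fix \<epsilon> :: real assume "\<epsilon> > 0"
  with nrm have "\<forall>\<^sub>F p in at (y, \<alpha>) within epi (marginal f).
      (\<xi>, c) \<bullet> (p - (y, \<alpha>)) \<le> \<epsilon> * norm (p - (y, \<alpha>))"
    unfolding regular_normal_cone_iff by blast
  then obtain d where "d > 0"
    and d: "\<And>p. \<lbrakk>p \<in> epi (marginal f); p \<noteq> (y, \<alpha>); dist p (y, \<alpha>) < d\<rbrakk> \<Longrightarrow>
      (\<xi>, c) \<bullet> (p - (y, \<alpha>)) \<le> \<epsilon> * norm (p - (y, \<alpha>))"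
    unfolding eventually_at by blast
  show "\<forall>\<^sub>F q in at ((x, y), \<alpha>) within epi f.
      ((0, \<xi>), c) \<bullet> (q - ((x, y), \<alpha>)) \<le> \<epsilon> * norm (q - ((x, y), \<alpha>))"
    unfolding eventually_at
  proof (intro exI[of _ d] conjI ballI impI)
    fix q assume q: "q \<in> epi f" "q \<noteq> ((x, y), \<alpha>) \<and> dist q ((x, y), \<alpha>) < d"
    obtain x' y' \<alpha>' where q_eq: "q = ((x', y'), \<alpha>')" by (metis prod.collapse)
    let ?p = "(y', \<alpha>')"
    have "marginal f y' \<le> f (x', y')" unfolding marginal_def by (rule INF_lower) simp
    with q(1) have p_epi: "?p \<in> epi (marginal f)" by (auto simp: q_eq epi_def)
    have norm_le: "norm (?p - (y, \<alpha>)) \<le> norm (q - ((x, y), \<alpha>))"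
      by (simp add: q_eq norm_Pair)
    have "(\<xi>, c) \<bullet> (?p - (y, \<alpha>)) \<le> \<epsilon> * norm (?p - (y, \<alpha>))"
    proof (cases "?p = (y, \<alpha>)")
      case False
      with p_epi norm_le q(2) show ?thesis by (intro d) (auto simp: dist_norm)
    qed simp
    also have "\<dots> \<le> \<epsilon> * norm (q - ((x, y), \<alpha>))"
      using norm_le \<open>\<epsilon> > 0\<close> by simp
    finally show "((0, \<xi>), c) \<bullet> (q - ((x, y), \<alpha>)) \<le> \<epsilon> * norm (q - ((x, y), \<alpha>))"
      by (simp add: q_eq)
  qed (fact \<open>d > 0\<close>)
qed

section \<open>Sequences of normals at graph points\<close>

text \<open>The step lengths \<open>t\<close> and the difference quotients \<open>w\<close>, \<open>m\<close> are separate arguments because the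
  same points and normals have to be described with respect to different step lengths.\<close>

definition graph_normals ::
    "('a::real_inner \<Rightarrow> ereal) \<Rightarrow> 'a \<Rightarrow> (nat \<Rightarrow> real) \<Rightarrow> (nat \<Rightarrow> 'a) \<Rightarrow> (nat \<Rightarrow> real) \<Rightarrow>
      (nat \<Rightarrow> 'a) \<Rightarrow> (nat \<Rightarrow> real) \<Rightarrow> bool"
  where "graph_normals g z t w m \<zeta> c \<longleftrightarrow> decr_to_zero t \<and>
    (\<forall>k. g (z + t k *\<^sub>R w k) = ereal (real_of_ereal (g z) + t k * m k)) \<and>
    (\<forall>k. (\<zeta> k, c k) \<in> regular_normal_cone (epi g)
            (z + t k *\<^sub>R w k, real_of_ereal (g z) + t k * m k))"

lemma decr_to_zero_subseq:
  assumes "decr_to_zero t" "strict_mono r"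
  shows "decr_to_zero (\<lambda>k. t (r k))"
  using assms LIMSEQ_subseq_LIMSEQ[of t 0 r] by (auto simp: decr_to_zero_def o_def)

lemma graph_normals_subseq:
  assumes "graph_normals g z t w m \<zeta> c" "strict_mono r"
  shows "graph_normals g z (\<lambda>k. t (r k)) (\<lambda>k. w (r k)) (\<lambda>k. m (r k)) (\<lambda>k. \<zeta> (r k)) (\<lambda>k. c (r k))"
  using assms by (simp add: graph_normals_def decr_to_zero_subseq)

text \<open>The last components of the normals tend to \<open>-1\<close>, so a tail of the defining sequence consists
  of normals with negative last component, whose base points lie on the graph.\<close>

lemma dir_subdiffE_graph_normals:
  fixes g :: "'a::real_inner \<Rightarrow> ereal"
  assumes "\<xi> \<in> dir_subdiff g z (u, \<nu>)"
  obtains t w m \<zeta> c where "graph_normals g z t w m \<zeta> c"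
    "w \<longlonglongrightarrow> u" "m \<longlonglongrightarrow> \<nu>" "\<zeta> \<longlonglongrightarrow> \<xi>" "c \<longlonglongrightarrow> -1"
proof -
  obtain t d e where t: "decr_to_zero t" and d: "d \<longlonglongrightarrow> (u, \<nu>)" and e: "e \<longlonglongrightarrow> (\<xi>, -1)"
    and nrm: "\<And>k. e k \<in> regular_normal_cone (epi g) ((z, real_of_ereal (g z)) + t k *\<^sub>R d k)"
    using assms unfolding dir_subdiff_def dir_normal_cone_def by blast
  have lims: "(\<lambda>k. fst (d k)) \<longlonglongrightarrow> u" "(\<lambda>k. snd (d k)) \<longlonglongrightarrow> \<nu>"
    "(\<lambda>k. fst (e k)) \<longlonglongrightarrow> \<xi>" "(\<lambda>k. snd (e k)) \<longlonglongrightarrow> -1"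
    using tendsto_fst[OF d] tendsto_snd[OF d] tendsto_fst[OF e] tendsto_snd[OF e] by simp_all
  have "\<forall>\<^sub>F k in sequentially. snd (e k) < 0"
    using order_tendstoD(2)[OF lims(4), of 0] by simp
  then obtain N where N: "\<And>k. snd (e (k + N)) < 0"
    unfolding eventually_sequentially by (meson le_add2)
  have nrm': "(fst (e k), snd (e k)) \<in> regular_normal_cone (epi g)
      (z + t k *\<^sub>R fst (d k), real_of_ereal (g z) + t k * snd (d k))" for k
    using nrm[of k] by (cases "d k") simp
  have "strict_mono (\<lambda>k. k + N)" by (simp add: strict_mono_def)
  from decr_to_zero_subseq[OF t this]
  have "graph_normals g z (\<lambda>k. t (k + N)) (\<lambda>k. fst (d (k + N))) (\<lambda>k. snd (d (k + N)))
      (\<lambda>k. fst (e (k + N))) (\<lambda>k. snd (e (k + N)))"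
    using nrm' value_eq_of_regular_normal_epi[OF nrm' N] unfolding graph_normals_def by blast
  then show thesis by (rule that) (rule LIMSEQ_ignore_initial_segment lims)+
qed

lemma graph_normals_limit:
  fixes g :: "'a::real_inner \<Rightarrow> ereal"
  assumes fin: "\<bar>g z\<bar> \<noteq> \<infinity>" and gn: "graph_normals g z t w m \<zeta> c"
    and lims: "w \<longlonglongrightarrow> u" "m \<longlonglongrightarrow> \<nu>" "\<zeta> \<longlonglongrightarrow> \<xi>" "c \<longlonglongrightarrow> -1"
  shows "\<nu> \<in> graph_deriv g z u" "\<xi> \<in> dir_subdiff g z (u, \<nu>)"
proof -
  have t: "decr_to_zero t"
    and val: "\<And>k. g (z + t k *\<^sub>R w k) = ereal (real_of_ereal (g z) + t k * m k)"
    and nrm: "\<And>k. (\<zeta> k, c k) \<in> regular_normal_cone (epi g)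
        (z + t k *\<^sub>R w k, real_of_ereal (g z) + t k * m k)"
    using gn by (auto simp: graph_normals_def)
  have dir: "(\<lambda>k. (w k, m k)) \<longlonglongrightarrow> (u, \<nu>)" using lims by (intro tendsto_Pair)
  have "(z, real_of_ereal (g z)) \<in> gph g" using fin by (auto simp: gph_def ereal_real')
  moreover have "\<forall>k. (z, real_of_ereal (g z)) + t k *\<^sub>R (w k, m k) \<in> gph g"
    using val by (simp add: gph_def)
  ultimately show "\<nu> \<in> graph_deriv g z u"
    using fin dir t unfolding graph_deriv_def tangent_cone_def by blast
  have "(\<lambda>k. (\<zeta> k, c k)) \<longlonglongrightarrow> (\<xi>, -1)" using lims by (intro tendsto_Pair)
  moreover have "\<forall>k. (\<zeta> k, c k) \<in>
      regular_normal_cone (epi g) ((z, real_of_ereal (g z)) + t k *\<^sub>R (w k, m k))"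
    using nrm by simp
  ultimately show "\<xi> \<in> dir_subdiff g z (u, \<nu>)"
    using fin dir t unfolding dir_subdiff_def dir_normal_cone_def by blast
qed

text \<open>Lifting to solutions, with the step lengths \<open>t\<close> exchanged for any positive null sequence \<open>s\<close>; this is
  where the two possible rates of \<open>x\<close> are treated alike.\<close>

lemma graph_normals_marginal_lift:
  fixes f :: "'a::real_inner \<times> 'b::real_inner \<Rightarrow> ereal"
  assumes gn: "graph_normals (marginal f) ybar t w m \<zeta> c"
    and xbar: "xbar \<in> solution_map f ybar"
    and x: "\<And>k. x k \<in> solution_map f (ybar + t k *\<^sub>R w k)"
    and s: "decr_to_zero s"
  shows "graph_normals f (xbar, ybar) s
    (\<lambda>k. ((x k - xbar) /\<^sub>R s k, (t k / s k) *\<^sub>R w k)) (\<lambda>k. (t k / s k) * m k) (\<lambda>k. (0, \<zeta> k)) c"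
proof -
  have "s k \<noteq> 0" for k using s by (simp add: decr_to_zero_def less_imp_neq[symmetric])
  then have pt: "(xbar, ybar) + s k *\<^sub>R ((x k - xbar) /\<^sub>R s k, (t k / s k) *\<^sub>R w k)
        = (x k, ybar + t k *\<^sub>R w k)"
    and stp: "s k * ((t k / s k) * m k) = t k * m k" for k
    by simp_all
  have base: "f (xbar, ybar) = marginal f ybar" using xbar by (simp add: solution_map_def)
  have val: "f (x k, ybar + t k *\<^sub>R w k) =
      ereal (real_of_ereal (marginal f ybar) + t k * m k)" for k
    using x[of k] gn by (simp add: solution_map_def graph_normals_def)
  moreover have "((0, \<zeta> k), c k) \<in> regular_normal_cone (epi f)
      ((x k, ybar + t k *\<^sub>R w k), real_of_ereal (marginal f ybar) + t k * m k)" for k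
    using gn val[of k] by (intro regular_normal_epi_marginal_lift) (simp_all add: graph_normals_def)
  ultimately show ?thesis
    unfolding graph_normals_def pt stp base using s by blast
qed

section \<open>The rate of convergence of the solutions\<close>

lemma convergent_quotient_of_bounded_rate:
  fixes x :: "nat \<Rightarrow> 'a::euclidean_space"
  assumes t: "decr_to_zero t" and rate: "\<And>k. norm (x k - xbar) \<le> C * t k"
  obtains r h where "strict_mono (r :: nat \<Rightarrow> nat)" "(\<lambda>k. (x (r k) - xbar) /\<^sub>R t (r k)) \<longlonglongrightarrow> h"
proof -
  have "norm ((x k - xbar) /\<^sub>R t k) \<le> C" for k
  proof -
    have "0 < t k" using t by (simp add: decr_to_zero_def)
    then have "norm ((x k - xbar) /\<^sub>R t k) = norm (x k - xbar) / t k"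
      by (simp add: divide_inverse_commute)
    with \<open>0 < t k\<close> show ?thesis using rate[of k] by (simp add: pos_divide_le_eq)
  qed
  then have "\<forall>k. (x k - xbar) /\<^sub>R t k \<in> cball 0 C" by simp
  then show thesis
    using compact_cball[of "0::'a" C, unfolded compact_def, rule_format,
        of "\<lambda>k. (x k - xbar) /\<^sub>R t k"] that by (auto simp: o_def)
qed

text \<open>If no subsequence has a bounded rate, then \<open>\<parallel>x\<^sub>k - xbar\<parallel>\<close> eventually exceeds every multiple of
  \<open>t\<^sub>k\<close>; in particular it is eventually positive and can serve as a step length.\<close>

lemma bounded_rate_or_dominating:
  fixes x :: "nat \<Rightarrow> 'a::euclidean_space"
  assumes t: "decr_to_zero t" and x: "x \<longlonglongrightarrow> xbar"
  obtains (bounded) r C where "strict_mono (r :: nat \<Rightarrow> nat)"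
      "\<And>k. norm (x (r k) - xbar) \<le> C * t (r k)"
  | (dominating) r h where "strict_mono (r :: nat \<Rightarrow> nat)"
      "decr_to_zero (\<lambda>k. norm (x (r k) - xbar))"
      "(\<lambda>k. t (r k) / norm (x (r k) - xbar)) \<longlonglongrightarrow> 0"
      "(\<lambda>k. (x (r k) - xbar) /\<^sub>R norm (x (r k) - xbar)) \<longlonglongrightarrow> h" "norm h = 1"
proof (cases "\<exists>C. infinite {k. norm (x k - xbar) \<le> C * t k}")
  case True
  then obtain C where "infinite {k. norm (x k - xbar) \<le> C * t k}" by blast
  from infinite_enumerate[OF this] show thesis using bounded by blast
next
  case False
  let ?\<tau> = "\<lambda>k. norm (x k - xbar)"
  have t_pos: "0 < t k" for k using t by (simp add: decr_to_zero_def)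
  have dom: "\<forall>\<^sub>F k in sequentially. C * t k < ?\<tau> k" for C
  proof -
    have "finite {k. \<not> C * t k < ?\<tau> k}" using False by (simp add: not_less)
    then show ?thesis unfolding cofinite_eq_sequentially[symmetric] eventually_cofinite .
  qed
  have "\<forall>\<^sub>F k in sequentially. 0 < ?\<tau> k" using dom[of 0] by simp
  then obtain N where N: "\<And>k. 0 < ?\<tau> (k + N)"
    unfolding eventually_sequentially by (meson le_add2)
  have ratio: "(\<lambda>k. t k / ?\<tau> k) \<longlonglongrightarrow> 0"
  proof (rule tendstoI)
    fix e :: real assume "0 < e"
    from dom[of "1 / e"] dom[of 0]
    show "\<forall>\<^sub>F k in sequentially. dist (t k / ?\<tau> k) 0 < e"
    proof eventually_elim
      case (elim k)
      then have "t k < e * ?\<tau> k" "0 < ?\<tau> k"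
        using \<open>0 < e\<close> by (simp_all add: field_simps)
      then show ?case using t_pos[of k] by (simp add: field_simps)
    qed
  qed
  have \<tau>0: "?\<tau> \<longlonglongrightarrow> 0"
    using tendsto_norm[OF LIM_zero[OF x]] by simp
  have "\<forall>k. (x (k + N) - xbar) /\<^sub>R ?\<tau> (k + N) \<in> sphere 0 1"
    using N by (auto simp: less_imp_neq[symmetric])
  then obtain h q where h: "h \<in> sphere (0::'a) 1" and q: "strict_mono (q :: nat \<Rightarrow> nat)"
    and lim: "(\<lambda>k. (x (q k + N) - xbar) /\<^sub>R ?\<tau> (q k + N)) \<longlonglongrightarrow> h"
    using compact_sphere[of "0::'a" 1, unfolded compact_def, rule_format,
        of "\<lambda>k. (x (k + N) - xbar) /\<^sub>R ?\<tau> (k + N)"] by (auto simp: o_def)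
  let ?r = "\<lambda>k. q k + N"
  have r: "strict_mono ?r" using q by (simp add: strict_mono_def)
  show thesis
  proof (rule dominating[OF r _ _ lim])
    show "decr_to_zero (\<lambda>k. ?\<tau> (?r k))"
      using N LIMSEQ_subseq_LIMSEQ[OF \<tau>0 r] by (simp add: decr_to_zero_def o_def)
    show "(\<lambda>k. t (?r k) / ?\<tau> (?r k)) \<longlonglongrightarrow> 0"
      using LIMSEQ_subseq_LIMSEQ[OF ratio r] by (simp add: o_def)
    show "norm h = 1" using h by simp
  qed
qed

section \<open>Subgradients of the marginal function\<close>

lemma subdiff_union_of_bounded_rate:
  fixes f :: "'a::euclidean_space \<times> 'b::real_inner \<Rightarrow> ereal"
  assumes fin: "\<bar>marginal f ybar\<bar> \<noteq> \<infinity>"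
    and gn: "graph_normals (marginal f) ybar t w m \<zeta> c"
    and lims: "w \<longlonglongrightarrow> v" "m \<longlonglongrightarrow> \<mu>" "\<zeta> \<longlonglongrightarrow> ystar" "c \<longlonglongrightarrow> -1"
    and xbar: "xbar \<in> solution_map f ybar"
    and x: "\<And>k. x k \<in> solution_map f (ybar + t k *\<^sub>R w k)"
    and rate: "\<And>k. norm (x k - xbar) \<le> C * t k"
  shows "(0, ystar) \<in> subdiff_union f ybar v \<mu> xbar"
proof -
  have t: "decr_to_zero t" using gn by (simp add: graph_normals_def)
  from t rate obtain r h where r: "strict_mono (r :: nat \<Rightarrow> nat)"
    and h: "(\<lambda>k. (x (r k) - xbar) /\<^sub>R t (r k)) \<longlonglongrightarrow> h"
    by (rule convergent_quotient_of_bounded_rate)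
  have "t k / t k = 1" for k
    using t by (simp add: decr_to_zero_def less_imp_neq[symmetric])
  with graph_normals_marginal_lift[OF graph_normals_subseq[OF gn r] xbar x decr_to_zero_subseq[OF t r]]
  have gn': "graph_normals f (xbar, ybar) (\<lambda>k. t (r k))
      (\<lambda>k. ((x (r k) - xbar) /\<^sub>R t (r k), w (r k))) (\<lambda>k. m (r k)) (\<lambda>k. (0, \<zeta> (r k))) (\<lambda>k. c (r k))"
    by simp
  have fin': "\<bar>f (xbar, ybar)\<bar> \<noteq> \<infinity>" using fin xbar by (simp add: solution_map_def)
  note sub = lims[THEN LIMSEQ_subseq_LIMSEQ, OF r, unfolded o_def]
  from graph_normals_limit[OF fin' gn' tendsto_Pair[OF h sub(1)] sub(2)
      tendsto_Pair[OF tendsto_const sub(3)] sub(4)]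
  show ?thesis unfolding subdiff_union_def by blast
qed

lemma subdiff_unions_of_convergent_solutions:
  fixes f :: "'a::euclidean_space \<times> 'b::real_inner \<Rightarrow> ereal"
  assumes fin: "\<bar>marginal f ybar\<bar> \<noteq> \<infinity>"
    and gn: "graph_normals (marginal f) ybar t w m \<zeta> c"
    and lims: "w \<longlonglongrightarrow> v" "m \<longlonglongrightarrow> \<mu>" "\<zeta> \<longlonglongrightarrow> ystar" "c \<longlonglongrightarrow> -1"
    and xbar: "xbar \<in> solution_map f ybar"
    and x: "\<And>k. x k \<in> solution_map f (ybar + t k *\<^sub>R w k)"
    and xlim: "x \<longlonglongrightarrow> xbar"
  shows "(0, ystar) \<in> subdiff_union f ybar v \<mu> xbar \<union> singular_subdiff_union f ybar xbar"
proof -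
  have t: "decr_to_zero t" using gn by (simp add: graph_normals_def)
  note sub = lims[THEN LIMSEQ_subseq_LIMSEQ, unfolded o_def]
  from t xlim show ?thesis
  proof (cases rule: bounded_rate_or_dominating)
    case (bounded r C)
    from subdiff_union_of_bounded_rate[OF fin graph_normals_subseq[OF gn bounded(1)]
        sub[OF bounded(1)] xbar x bounded(2)]
    show ?thesis by blast
  next
    case (dominating r h)
    let ?\<tau> = "\<lambda>k. norm (x (r k) - xbar)"
    note sub = sub[OF dominating(1)]
    \<comment> \<open>With respect to \<open>?\<tau>\<close> the difference quotients in \<open>y\<close> and in the value carry the factor
      \<open>t / ?\<tau>\<close> and vanish in the limit.\<close>
    have dir: "(\<lambda>k. ((x (r k) - xbar) /\<^sub>R ?\<tau> k, (t (r k) / ?\<tau> k) *\<^sub>R w (r k))) \<longlonglongrightarrow> (h, 0)"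
      using tendsto_Pair[OF dominating(4) tendsto_scaleR[OF dominating(3) sub(1)]] by simp
    have val: "(\<lambda>k. (t (r k) / ?\<tau> k) * m (r k)) \<longlonglongrightarrow> 0"
      using tendsto_mult[OF dominating(3) sub(2)] by simp
    have fin': "\<bar>f (xbar, ybar)\<bar> \<noteq> \<infinity>" using fin xbar by (simp add: solution_map_def)
    from graph_normals_limit[OF fin'
        graph_normals_marginal_lift[OF graph_normals_subseq[OF gn dominating(1)] xbar x dominating(2)]
        dir val tendsto_Pair[OF tendsto_const sub(3)] sub(4)]
    show ?thesis using dominating(5) unfolding singular_subdiff_union_def by auto
  qed
qed

text \<open>The filter in the definition of lower semicontinuity omits the point itself, but a strict lower
  bound below the value holds there as well; so the sequence may return to its limit.\<close>

lemma lower_semicontinuous_le_limit: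
  fixes f :: "'a::topological_space \<Rightarrow> ereal"
  assumes "lower_semicontinuous f" "z \<longlonglongrightarrow> l" "(\<lambda>k. f (z k)) \<longlonglongrightarrow> b"
  shows "f l \<le> b"
proof (rule ccontr)
  assume "\<not> f l \<le> b"
  then obtain a where a: "b < a" "a < f l" using dense[of b "f l"] by (auto simp: not_le)
  have "f l \<le> Liminf (at l) f" using assms(1) by (simp add: lower_semicontinuous_def)
  with a(2) have "\<forall>\<^sub>F p in at l. a < f p" by (simp add: le_Liminf_iff)
  with a(2) have "\<forall>\<^sub>F p in nhds l. a < f p"
    unfolding eventually_at_filter by (auto elim: eventually_mono)
  with assms(2) have "\<forall>\<^sub>F k in sequentially. a < f (z k)" by (rule eventually_compose_filterlim[rotated])
  moreover have "\<forall>\<^sub>F k in sequentially. f (z k) < a" using assms(3) a(1) by (rule order_tendstoD)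
  ultimately have "\<forall>\<^sub>F k in sequentially. False" by eventually_elim simp
  then show False by simp
qed

text \<open>The values \<open>\<vartheta>(y\<^sub>k)\<close> along graph points approaching in a fixed direction tend to
  \<open>\<vartheta>(ybar)\<close>, since their difference quotients converge; lower semicontinuity of \<open>f\<close> does the rest.\<close>

lemma limit_of_solutions_is_solution:
  fixes f :: "'a::real_inner \<times> 'b::real_inner \<Rightarrow> ereal"
  assumes lsc: "lower_semicontinuous f" and fin: "\<bar>marginal f ybar\<bar> \<noteq> \<infinity>"
    and gn: "graph_normals (marginal f) ybar t w m \<zeta> c"
    and lims: "w \<longlonglongrightarrow> v" "m \<longlonglongrightarrow> \<mu>"
    and x: "\<And>k. x k \<in> solution_map f (ybar + t k *\<^sub>R w k)"
    and xlim: "x \<longlonglongrightarrow> xbar"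
  shows "xbar \<in> solution_map f ybar"
proof -
  have t: "t \<longlonglongrightarrow> 0" using gn by (simp add: graph_normals_def decr_to_zero_def)
  have val: "f (x k, ybar + t k *\<^sub>R w k) = ereal (real_of_ereal (marginal f ybar) + t k * m k)" for k
    using x[of k] gn by (simp add: solution_map_def graph_normals_def)
  have "(\<lambda>k. ybar + t k *\<^sub>R w k) \<longlonglongrightarrow> ybar"
    using tendsto_add[OF tendsto_const tendsto_scaleR[OF t lims(1)], of ybar] by simp
  then have "(\<lambda>k. (x k, ybar + t k *\<^sub>R w k)) \<longlonglongrightarrow> (xbar, ybar)"
    using xlim by (intro tendsto_Pair)
  moreover have "(\<lambda>k. real_of_ereal (marginal f ybar) + t k * m k) \<longlonglongrightarrow> real_of_ereal (marginal f ybar)"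
    using tendsto_add[OF tendsto_const tendsto_mult[OF t lims(2)]] by simp
  then have "(\<lambda>k. f (x k, ybar + t k *\<^sub>R w k)) \<longlonglongrightarrow> marginal f ybar"
    using fin tendsto_ereal by (fastforce simp: val ereal_real')
  ultimately have "f (xbar, ybar) \<le> marginal f ybar"
    by (rule lower_semicontinuous_le_limit[OF lsc])
  moreover have "marginal f ybar \<le> f (xbar, ybar)"
    unfolding marginal_def by (rule INF_lower) simp
  ultimately show ?thesis by (simp add: solution_map_def)
qed

text \<open>Scaling by \<open>t\<^sub>k\<close> cancels in the angular condition, which for \<open>w\<^sub>k \<rightarrow> v \<noteq> 0\<close> compares a null
  sequence with one tending to \<open>\<delta> \<parallel>v\<parallel>\<^sup>2 > 0\<close>; for \<open>v = 0\<close> both sides vanish.\<close>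

lemma eventually_in_dir_nbhd:
  fixes v :: "'a::real_normed_vector"
  assumes "dir_nbhd v V" and t: "decr_to_zero t" and w: "w \<longlonglongrightarrow> v"
  shows "\<forall>\<^sub>F k in sequentially. t k *\<^sub>R w k \<in> V"
proof -
  obtain \<rho> \<delta> where "\<rho> > 0" "\<delta> > 0" and V: "dir_nbhd_base \<rho> \<delta> v \<subseteq> V"
    using assms(1) by (auto simp: dir_nbhd_def)
  have t_pos: "0 < t k" for k using t by (simp add: decr_to_zero_def)
  have "(\<lambda>k. t k *\<^sub>R w k) \<longlonglongrightarrow> 0"
    using tendsto_scaleR[OF _ w, of t 0] t by (simp add: decr_to_zero_def)
  then have small: "\<forall>\<^sub>F k in sequentially. norm (t k *\<^sub>R w k) < \<rho>"
    using \<open>\<rho> > 0\<close> order_tendstoD(2)[OF tendsto_norm_zero] by blast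
  have angle: "\<forall>\<^sub>F k in sequentially.
      norm (norm v *\<^sub>R w k - norm (w k) *\<^sub>R v) \<le> \<delta> * norm (w k) * norm v"
  proof (cases "v = 0")
    case False
    have "(\<lambda>k. \<delta> * norm (w k) * norm v - norm (norm v *\<^sub>R w k - norm (w k) *\<^sub>R v))
        \<longlonglongrightarrow> \<delta> * norm v * norm v - norm (norm v *\<^sub>R v - norm v *\<^sub>R v)"
      by (intro tendsto_intros w)
    moreover have "0 < \<delta> * norm v * norm v - norm (norm v *\<^sub>R v - norm v *\<^sub>R v)"
      using False \<open>\<delta> > 0\<close> by simp
    ultimately have "\<forall>\<^sub>F k in sequentially.
        0 < \<delta> * norm (w k) * norm v - norm (norm v *\<^sub>R w k - norm (w k) *\<^sub>R v)"
      by (rule order_tendstoD)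
    then show ?thesis by eventually_elim simp
  qed simp
  from small angle show ?thesis
  proof eventually_elim
    case (elim k)
    have "norm v *\<^sub>R (t k *\<^sub>R w k) - norm (t k *\<^sub>R w k) *\<^sub>R v
        = t k *\<^sub>R (norm v *\<^sub>R w k - norm (w k) *\<^sub>R v)"
      using t_pos[of k] by (simp add: algebra_simps)
    then have "norm (norm v *\<^sub>R (t k *\<^sub>R w k) - norm (t k *\<^sub>R w k) *\<^sub>R v)
        = t k * norm (norm v *\<^sub>R w k - norm (w k) *\<^sub>R v)"
      using t_pos[of k] by simp
    also have "\<dots> \<le> t k * (\<delta> * norm (w k) * norm v)"
      using elim(2) t_pos[of k] by simp
    also have "\<dots> = \<delta> * norm (t k *\<^sub>R w k) * norm v"
      using t_pos[of k] by simp
    finally have "t k *\<^sub>R w k \<in> dir_nbhd_base \<rho> \<delta> v"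
      using elim(1) by (simp add: dir_nbhd_base_def)
    then show ?case using V by blast
  qed
qed

lemma inner_calm_solutions_of_bounded_rate:
  fixes S :: "'b::real_normed_vector \<Rightarrow> 'a::real_normed_vector set"
  assumes "inner_calm S ybar xbar v" and t: "decr_to_zero t" and w: "w \<longlonglongrightarrow> v"
  obtains r x C where "strict_mono (r :: nat \<Rightarrow> nat)"
    "\<And>k. x k \<in> S (ybar + t (r k) *\<^sub>R w (r k))" "\<And>k. norm (x k - xbar) \<le> C * t (r k)"
proof -
  obtain \<kappa> V where "\<kappa> > 0" and V: "dir_nbhd v V"
    and calm: "\<forall>y \<in> (+) ybar ` V. xbar \<in> (\<Union>x \<in> S y. cball x (\<kappa> * norm (y - ybar)))"
    using assms(1) by (auto simp: inner_calm_def)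
  obtain B where B: "\<And>k. norm (w k) \<le> B"
    using convergent_imp_Bseq[OF convergentI[OF w]] by (auto simp: Bseq_def)
  obtain N where N: "\<And>k. t (k + N) *\<^sub>R w (k + N) \<in> V"
    using eventually_in_dir_nbhd[OF V t w] unfolding eventually_sequentially by (meson le_add2)
  have "\<exists>a. a \<in> S (ybar + t (k + N) *\<^sub>R w (k + N)) \<and> norm (a - xbar) \<le> (\<kappa> * B) * t (k + N)" for k
  proof -
    have t_pos: "0 < t (k + N)" using t by (simp add: decr_to_zero_def)
    obtain a where a: "a \<in> S (ybar + t (k + N) *\<^sub>R w (k + N))"
      "dist a xbar \<le> \<kappa> * norm (t (k + N) *\<^sub>R w (k + N))"
      using calm N[of k] by fastforce
    have "\<kappa> * norm (t (k + N) *\<^sub>R w (k + N)) = \<kappa> * t (k + N) * norm (w (k + N))"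
      using t_pos by simp
    also have "\<dots> \<le> \<kappa> * t (k + N) * B"
      using t_pos \<open>\<kappa> > 0\<close> B by (intro mult_left_mono) simp_all
    finally show ?thesis using a by (auto simp: dist_norm mult_ac)
  qed
  then obtain x where "\<And>k. x k \<in> S (ybar + t (k + N) *\<^sub>R w (k + N))"
    "\<And>k. norm (x k - xbar) \<le> (\<kappa> * B) * t (k + N)"
    by metis
  then show thesis
    by (intro that[of "\<lambda>k. k + N" x "\<kappa> * B"]) (simp_all add: strict_mono_def)
qed

theorem theorem4p2:
  fixes f :: "(real ^ 'n) \<times> (real ^ 'l) \<Rightarrow> ereal"
    and ybar v :: "real ^ 'l" and \<mu> :: real
  assumes "lower_semicontinuous f"
    and "\<bar>marginal f ybar\<bar> \<noteq> \<infinity>"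
  shows
    "(inner_semicompact (solution_map f) ybar v \<longrightarrow>
       (\<forall>ystar \<in> dir_subdiff (marginal f) ybar (v, \<mu>).
          (0, ystar) \<in> (\<Union>xbar \<in> solution_map f ybar.
             subdiff_union f ybar v \<mu> xbar \<union> singular_subdiff_union f ybar xbar))) \<and>
     (\<forall>xbar \<in> solution_map f ybar. inner_semicontinuous (solution_map f) ybar xbar v \<longrightarrow>
       (\<forall>ystar \<in> dir_subdiff (marginal f) ybar (v, \<mu>).
          (0, ystar) \<in> subdiff_union f ybar v \<mu> xbar \<union> singular_subdiff_union f ybar xbar)) \<and>
     (\<forall>xbar \<in> solution_map f ybar. inner_calm (solution_map f) ybar xbar v \<longrightarrow>
       (\<forall>ystar \<in> dir_subdiff (marginal f) ybar (v, \<mu>).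
          (0, ystar) \<in> subdiff_union f ybar v \<mu> xbar))"
proof (intro conjI impI ballI)
  fix ystar assume compact: "inner_semicompact (solution_map f) ybar v"
    and "ystar \<in> dir_subdiff (marginal f) ybar (v, \<mu>)"
  from this(2) obtain t w m \<zeta> c where gn: "graph_normals (marginal f) ybar t w m \<zeta> c"
    and lims: "w \<longlonglongrightarrow> v" "m \<longlonglongrightarrow> \<mu>" "\<zeta> \<longlonglongrightarrow> ystar" "c \<longlonglongrightarrow> -1"
    by (rule dir_subdiffE_graph_normals)
  have "decr_to_zero t" using gn by (simp add: graph_normals_def)
  with compact lims(1) obtain r x xbar where r: "strict_mono (r :: nat \<Rightarrow> nat)"
    and x: "\<And>j. x j \<in> solution_map f (ybar + t (r j) *\<^sub>R w (r j))" and xlim: "x \<longlonglongrightarrow> xbar"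
    unfolding inner_semicompact_def convergent_def by metis
  note gn = graph_normals_subseq[OF gn r]
    and lims = lims[THEN LIMSEQ_subseq_LIMSEQ, OF r, unfolded o_def]
  have xbar: "xbar \<in> solution_map f ybar"
    by (rule limit_of_solutions_is_solution[OF assms gn lims(1,2) x xlim])
  with subdiff_unions_of_convergent_solutions[OF assms(2) gn lims xbar x xlim]
  show "(0, ystar) \<in> (\<Union>xbar \<in> solution_map f ybar.
      subdiff_union f ybar v \<mu> xbar \<union> singular_subdiff_union f ybar xbar)"
    by blast
next
  fix xbar ystar assume xbar: "xbar \<in> solution_map f ybar"
    and cont: "inner_semicontinuous (solution_map f) ybar xbar v"
    and "ystar \<in> dir_subdiff (marginal f) ybar (v, \<mu>)"
  from this(3) obtain t w m \<zeta> c where gn: "graph_normals (marginal f) ybar t w m \<zeta> c"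
    and lims: "w \<longlonglongrightarrow> v" "m \<longlonglongrightarrow> \<mu>" "\<zeta> \<longlonglongrightarrow> ystar" "c \<longlonglongrightarrow> -1"
    by (rule dir_subdiffE_graph_normals)
  have "decr_to_zero t" using gn by (simp add: graph_normals_def)
  with cont lims(1) obtain r x where r: "strict_mono (r :: nat \<Rightarrow> nat)"
    and x: "\<And>j. x j \<in> solution_map f (ybar + t (r j) *\<^sub>R w (r j))" and xlim: "x \<longlonglongrightarrow> xbar"
    unfolding inner_semicontinuous_def by metis
  show "(0, ystar) \<in> subdiff_union f ybar v \<mu> xbar \<union> singular_subdiff_union f ybar xbar"
    by (rule subdiff_unions_of_convergent_solutions[OF assms(2) graph_normals_subseq[OF gn r]
        lims[THEN LIMSEQ_subseq_LIMSEQ, OF r, unfolded o_def] xbar x xlim])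
next
  fix xbar ystar assume xbar: "xbar \<in> solution_map f ybar"
    and calm: "inner_calm (solution_map f) ybar xbar v"
    and "ystar \<in> dir_subdiff (marginal f) ybar (v, \<mu>)"
  from this(3) obtain t w m \<zeta> c where gn: "graph_normals (marginal f) ybar t w m \<zeta> c"
    and lims: "w \<longlonglongrightarrow> v" "m \<longlonglongrightarrow> \<mu>" "\<zeta> \<longlonglongrightarrow> ystar" "c \<longlonglongrightarrow> -1"
    by (rule dir_subdiffE_graph_normals)
  have "decr_to_zero t" using gn by (simp add: graph_normals_def)
  from calm this lims(1) obtain r x C where r: "strict_mono (r :: nat \<Rightarrow> nat)"
    and x: "\<And>k. x k \<in> solution_map f (ybar + t (r k) *\<^sub>R w (r k))"
    and rate: "\<And>k. norm (x k - xbar) \<le> C * t (r k)"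
    by (rule inner_calm_solutions_of_bounded_rate) (rule that)
  show "(0, ystar) \<in> subdiff_union f ybar v \<mu> xbar"
    by (rule subdiff_union_of_bounded_rate[OF assms(2) graph_normals_subseq[OF gn r]
        lims[THEN LIMSEQ_subseq_LIMSEQ, OF r, unfolded o_def] xbar x rate])
qed

end
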